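(* Let $G=(V,E)$ be a finite undirected graph (loops and multiple edges allowed), and let $W\subseteq V$ with $V\backslash W=\{v_1,v_2,\dots,v_n\}$ (distinct vertices). Then the number of bases of the matroid $\mathrm{TM}(G,W)$ is equal to $$\sum_{(a_1,a_2,\dots,a_n)\in D^+(G[V\backslash W])}\ \prod_{i=1}^n\binom{\deg_G(v_i)}{a_i},$$ where $G[V\backslash W]$ is the induced subgraph of $G$ on $V\backslash W$.
   Context: Degree: $\deg_G(v)$ is the number of edges of $G$ incident to $v$, where a loop at $v$ contributes $2$. Labelings: let $\infty$ be a symbol with $\infty\notin V$, and let $\alpha=(m(v),\,v\in V)$ be a vector of non-negative integers. A labeling of $G$ with respect to $\alpha$ is a map $\varphi:E\to V\cup\{\infty\}$ such that (i) for every $e\in E$ with ends $v$ and $w$, $\varphi(e)\in\{v,w,\infty\}$; and (ii) $|\varphi^{-1}(v)|\leq m(v)$ for each $v\in V$. Its height is $\mathrm{Hei}(\varphi):=|\{e\in E\mid \varphi(e)\neq\infty\}|$. The matroid $\mathrm{TM}(G)$: let $S_G:=\{(v,i)\in V\times\mathbb{N}\mid 1\leq i\leq\deg_G(v)\}$. For $X\subseteq S_G$ let $\alpha(X):=(m_X(v),\,v\in V)$ with $m_X(v):=|\{i\mid (v,i)\in X\}|$, and let $r_G(X)$ be the maximum of $\mathrm{Hei}(\varphi)$ over all labelings $\varphi$ of $G$ with respect to $\alpha(X)$. The function $r_G$ is the rank function of a matroid on $S_G$, and $\mathrm{TM}(G)$ denotes this matroid. The matroid $\mathrm{TM}(G,W)$: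 for $W\subseteq V$, let $S_G(W):=\{(v,i)\in W\times\mathbb{N}\mid 1\leq i\leq\deg_G(v)\}$. Then $\mathrm{TM}(G,W):=\mathrm{TM}(G)\backslash S_G(W)$ (matroid deletion). Orientations: an orientation $\mathcal{O}$ of a graph $H$ assigns a direction to each edge of $H$; the out-degree $\deg^+_{\mathcal{O}}(v)$ is the number of arcs with tail $v$ (a directed loop at $v$ has tail $v$ and head $v$, so counts once). For a graph $H$ with vertices $v_1,\dots,v_n$, two orientations are equivalent if they have the same out-degree vector $(\deg^+_{\mathcal{O}}(v_1),\dots,\deg^+_{\mathcal{O}}(v_n))$. $D^+(H)$ is the set of equivalence classes, each identified with its common out-degree vector; thus $D^+(H)$ is the set of distinct out-degree vectors of orientations of $H$. *)

theory Defs
  imports "HOL-Library.Uprod"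
begin

section \<open>Finite undirected multigraphs\<close>

text \<open>
  Edges have an identity of their own, so parallel edges are allowed; the ends of an edge
  form an unordered pair, and an edge \<open>e\<close> is a loop at \<open>v\<close> iff \<open>ends G e = Upair v v\<close>.
\<close>

record ('v, 'e) multigraph =
  verts :: "'v set"
  edges :: "'e set"
  ends :: "'e \<Rightarrow> 'v uprod"

locale fin_multigraph =
  fixes G :: "('v, 'e) multigraph"
  assumes finite_verts: "finite (verts G)"
    and finite_edges: "finite (edges G)"
    and ends_in_verts: "e \<in> edges G \<Longrightarrow> set_uprod (ends G e) \<subseteq> verts G"

text \<open>A loop lies in both of the sets below and hence contributes 2.\<close>

definition deg :: "('v, 'e) multigraph \<Rightarrow> 'v \<Rightarrow> nat" where
  "deg G v = card {e \<in> edges G. v \<in> set_uprod (ends G e)}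
           + card {e \<in> edges G. ends G e = Upair v v}"

definition induced_subgraph :: "('v, 'e) multigraph \<Rightarrow> 'v set \<Rightarrow> ('v, 'e) multigraph" where
  "induced_subgraph G U =
     \<lparr>verts = U, edges = {e \<in> edges G. set_uprod (ends G e) \<subseteq> U}, ends = ends G\<rparr>"


section \<open>Labelings\<close>

text \<open>
  The symbol \<open>\<infinity>\<close> is rendered as \<open>None\<close> and a vertex \<open>v\<close> used as a label as \<open>Some v\<close>.  Only the
  values of a labeling on the edges of the graph are relevant.
\<close>

definition labeling ::
  "('v, 'e) multigraph \<Rightarrow> ('v \<Rightarrow> nat) \<Rightarrow> ('e \<Rightarrow> 'v option) \<Rightarrow> bool" where
  "labeling G m \<phi> \<longleftrightarrow>
     (\<forall>e \<in> edges G. \<phi> e \<in> insert None (Some ` set_uprod (ends G e))) \<and>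
     (\<forall>v \<in> verts G. card {e \<in> edges G. \<phi> e = Some v} \<le> m v)"

definition height :: "('v, 'e) multigraph \<Rightarrow> ('e \<Rightarrow> 'v option) \<Rightarrow> nat" where
  "height G \<phi> = card {e \<in> edges G. \<phi> e \<noteq> None}"


section \<open>Matroids given by a rank function\<close>

text \<open>
  The record carries only the data of a matroid; the rank function is meaningful on
  subsets of the ground set.
\<close>

record 'a matroid =
  ground :: "'a set"
  rk :: "'a set \<Rightarrow> nat"

definition indep :: "'a matroid \<Rightarrow> 'a set \<Rightarrow> bool" where
  "indep M X \<longleftrightarrow> X \<subseteq> ground M \<and> finite X \<and> rk M X = card X"

definition basis :: "'a matroid \<Rightarrow> 'a set \<Rightarrow> bool" where
  "basis M B \<longleftrightarrow> indep M B \<and> (\<forall>X. indep M X \<longrightarrow> B \<subseteq> X \<longrightarrow> X = B)"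

text \<open>The rank function of a deletion is the restriction of the original one.\<close>

definition matroid_delete :: "'a matroid \<Rightarrow> 'a set \<Rightarrow> 'a matroid" where
  "matroid_delete M D = \<lparr>ground = ground M - D, rk = rk M\<rparr>"


section \<open>The matroids \<open>TM(G)\<close> and \<open>TM(G,W)\<close>\<close>

definition S_G :: "('v, 'e) multigraph \<Rightarrow> 'v set \<Rightarrow> ('v \<times> nat) set" where
  "S_G G W = {(v, i). v \<in> W \<and> 1 \<le> i \<and> i \<le> deg G v}"

definition mult :: "('v \<times> nat) set \<Rightarrow> 'v \<Rightarrow> nat" where
  "mult X v = card {i. (v, i) \<in> X}"

definition label_rank :: "('v, 'e) multigraph \<Rightarrow> ('v \<times> nat) set \<Rightarrow> nat" where
  "label_rank G X = Max {height G \<phi> | \<phi>. labeling G (mult X) \<phi>}"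

definition TM :: "('v, 'e) multigraph \<Rightarrow> ('v \<times> nat) matroid" where
  "TM G = \<lparr>ground = S_G G (verts G), rk = label_rank G\<rparr>"

definition TM_del :: "('v, 'e) multigraph \<Rightarrow> 'v set \<Rightarrow> ('v \<times> nat) matroid" where
  "TM_del G W = matroid_delete (TM G) (S_G G W)"


section \<open>Orientations\<close>

text \<open>
  An orientation sends each edge to its pair (tail, head).  A loop has only one such pair,
  which does not affect the set of out-degree vectors.
\<close>

definition orientation :: "('v, 'e) multigraph \<Rightarrow> ('e \<Rightarrow> 'v \<times> 'v) \<Rightarrow> bool" where
  "orientation H \<O> \<longleftrightarrow> (\<forall>e \<in> edges H. Upair (fst (\<O> e)) (snd (\<O> e)) = ends H e)"

definition out_deg :: "('v, 'e) multigraph \<Rightarrow> ('e \<Rightarrow> 'v \<times> 'v) \<Rightarrow> 'v \<Rightarrow> nat" where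
  "out_deg H \<O> v = card {e \<in> edges H. fst (\<O> e) = v}"

text \<open>
  The list \<open>vs\<close> enumerates the vertices of \<open>H\<close>.  Each equivalence class of orientations is
  represented by its common out-degree vector.
\<close>

definition D_plus :: "('v, 'e) multigraph \<Rightarrow> 'v list \<Rightarrow> nat list set" where
  "D_plus H vs = {map (out_deg H \<O>) vs | \<O>. orientation H \<O>}"

end

theory Submission
  imports Defs "HOL-Library.FuncSet"
begin

text \<open>
  Put \<open>U = V - W\<close>.  A set \<open>X\<close> over \<open>U\<close> is independent iff some labeling uses every vertex \<open>v\<close>
  exactly \<open>mult X v\<close> times.  An unlabeled edge with an end \<open>v\<close> in \<open>U\<close> can be labeled \<open>v\<close>, and since
  \<open>v\<close> labels at most \<open>deg v\<close> edges there is room to enlarge \<open>X\<close> over \<open>v\<close>; hence the bases are the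
  sets whose labeling covers all edges that meet \<open>U\<close>.  On edges inside \<open>U\<close> such a labeling
  selects the heads of an orientation of \<open>G[U]\<close>, and on edges between \<open>U\<close> and \<open>W\<close> it is forced,
  so the multiplicity of \<open>v\<close> in the basis is \<open>deg v\<close> minus the out-degree of \<open>v\<close>.  The symmetry
  of the binomial coefficients gives the formula.
\<close>

section \<open>Counting subsets of a disjoint union with prescribed fibre sizes\<close>

lemma card_subsets_Sigma_fibres:
  assumes "finite U" and "\<And>v. v \<in> U \<Longrightarrow> finite (D v)"
  shows "card {B. B \<subseteq> Sigma U D \<and> (\<forall>v\<in>U. card {i. (v, i) \<in> B} = k v)} =
    (\<Prod>v\<in>U. card (D v) choose k v)"
    (is "card ?L = _")
proof -
  let ?P = "PiE U (\<lambda>v. {A. A \<subseteq> D v \<and> card A = k v})"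
  \<comment> \<open>A subset of the disjoint union is the same as an independent choice of its
    fibres. Restricting the fibre map to \<open>U\<close> makes it extensional, so that the choices
    form a \<open>PiE\<close> and \<open>Sigma U\<close> is a two-sided inverse.\<close>
  have "bij_betw (\<lambda>B. \<lambda>v\<in>U. {i. (v, i) \<in> B}) ?L ?P"
  proof (rule bij_betw_byWitness[where f' = "Sigma U"])
    show "\<forall>B\<in>?L. Sigma U (\<lambda>v\<in>U. {i. (v, i) \<in> B}) = B"
      by auto
    show "\<forall>f\<in>?P. (\<lambda>v\<in>U. {i. (v, i) \<in> Sigma U f}) = f"
      by (auto simp: fun_eq_iff PiE_def extensional_def)
    show "(\<lambda>B. \<lambda>v\<in>U. {i. (v, i) \<in> B}) ` ?L \<subseteq> ?P"
      by auto
    show "Sigma U ` ?P \<subseteq> ?L"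
      by (fastforce simp: PiE_iff)
  qed
  then have "card ?L = card ?P"
    by (rule bij_betw_same_card)
  also have "\<dots> = (\<Prod>v\<in>U. card (D v) choose k v)"
    using assms by (simp add: card_PiE n_subsets)
  finally show ?thesis .
qed

section \<open>Exact and covering labelings, and degrees under orientations\<close>

definition exact_labeling ::
  "('v, 'e) multigraph \<Rightarrow> ('v \<Rightarrow> nat) \<Rightarrow> ('e \<Rightarrow> 'v option) \<Rightarrow> bool" where
  "exact_labeling G m \<phi> \<longleftrightarrow>
     (\<forall>e \<in> edges G. \<phi> e \<in> insert None (Some ` set_uprod (ends G e))) \<and>
     (\<forall>v \<in> verts G. card {e \<in> edges G. \<phi> e = Some v} = m v)"

text \<open>Edges that avoid \<open>U\<close> are left free: when all multiplicities vanish off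
  \<open>U\<close>, an exact labeling must give them \<open>None\<close>, so a covering labeling has
  the greatest possible height.\<close>

definition covers :: "('v, 'e) multigraph \<Rightarrow> 'v set \<Rightarrow> ('e \<Rightarrow> 'v option) \<Rightarrow> bool" where
  "covers G U \<phi> \<longleftrightarrow> (\<forall>e \<in> edges G. set_uprod (ends G e) \<inter> U \<noteq> {} \<longrightarrow> \<phi> e \<noteq> None)"

lemma S_G_eq_Sigma: "S_G G U = Sigma U (\<lambda>v. {1..deg G v})"
  by (auto simp: S_G_def)

text \<open>Inclusion-exclusion: the edges having \<open>v\<close> both as tail and as head are
  exactly the loops at \<open>v\<close>, which \<open>deg\<close> counts twice.\<close>

lemma out_deg_plus_in_deg:
  assumes "finite (edges H)" and "orientation H \<O>"
  shows "out_deg H \<O> v + card {e \<in> edges H. snd (\<O> e) = v} = deg H v"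
proof -
  have ends: "ends H e = Upair (fst (\<O> e)) (snd (\<O> e))" if "e \<in> edges H" for e
    using assms(2) that by (simp add: orientation_def)
  have "{e \<in> edges H. fst (\<O> e) = v} \<union> {e \<in> edges H. snd (\<O> e) = v} =
      {e \<in> edges H. v \<in> set_uprod (ends H e)}"
    using ends by auto
  moreover have "{e \<in> edges H. fst (\<O> e) = v} \<inter> {e \<in> edges H. snd (\<O> e) = v} =
      {e \<in> edges H. ends H e = Upair v v}"
    using ends by auto
  ultimately show ?thesis
    using card_Un_Int[of "{e \<in> edges H. fst (\<O> e) = v}" "{e \<in> edges H. snd (\<O> e) = v}"] assms(1)
    by (simp add: out_deg_def deg_def)
qed

lemma finite_D_plus:
  assumes "finite (edges H)"
  shows "finite (D_plus H vs)"
  by (rule finite_subset[OF _ finite_lists_length_eq[of "{..card (edges H)}" "length vs"]])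
    (use assms in \<open>auto simp: D_plus_def out_deg_def intro: card_mono\<close>)

context fin_multigraph
begin

section \<open>Independence expressed by exact labelings\<close>

lemma finite_S_G: "U \<subseteq> verts G \<Longrightarrow> finite (S_G G U)"
  unfolding S_G_eq_Sigma using finite_verts by (auto intro: finite_subset)

lemma card_eq_sum_mult:
  assumes "U \<subseteq> verts G" and "X \<subseteq> S_G G U"
  shows "card X = (\<Sum>v\<in>verts G. mult X v)"
proof -
  have fin: "finite X"
    using assms finite_S_G finite_subset by blast
  have "X = Sigma (verts G) (\<lambda>v. {i. (v, i) \<in> X})"
    using assms by (auto simp: S_G_def)
  moreover have "finite {i. (v, i) \<in> X}" for v
    by (rule finite_subset[OF _ finite_imageI[OF fin, of snd]]) force
  ultimately show ?thesis
    unfolding mult_def using card_SigmaI[OF finite_verts, of "\<lambda>v. {i. (v, i) \<in> X}"] by simp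
qed

text \<open>The labeled edges split into disjoint classes by label, and every label is an end of its
  edge, hence a vertex.\<close>

lemma height_eq_sum:
  assumes "\<forall>e \<in> edges G. \<phi> e \<in> insert None (Some ` set_uprod (ends G e))"
  shows "height G \<phi> = (\<Sum>v\<in>verts G. card {e \<in> edges G. \<phi> e = Some v})"
proof -
  have "{e \<in> edges G. \<phi> e \<noteq> None} = (\<Union>v\<in>verts G. {e \<in> edges G. \<phi> e = Some v})"
    using assms ends_in_verts by fastforce
  then have "height G \<phi> = card (\<Union>v\<in>verts G. {e \<in> edges G. \<phi> e = Some v})"
    by (simp only: height_def)
  also have "\<dots> = (\<Sum>v\<in>verts G. card {e \<in> edges G. \<phi> e = Some v})"
    using finite_verts finite_edges by (intro card_UN_disjoint) auto
  finally show ?thesis .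
qed

lemma mult_eq_0:
  assumes "X \<subseteq> S_G G U" and "v \<notin> U"
  shows "mult X v = 0"
proof -
  have "{i. (v, i) \<in> X} = {}"
    using assms by (auto simp: S_G_def)
  then show ?thesis
    by (simp add: mult_def)
qed

lemma ground_TM_del: "W \<subseteq> verts G \<Longrightarrow> ground (TM_del G W) = S_G G (verts G - W)"
  by (auto simp: TM_del_def TM_def matroid_delete_def S_G_def)

text \<open>Height and cardinality are sums over the vertices of the label counts and of the
  multiplicities. The counts are bounded by the multiplicities, so the two sums agree only if all
  terms agree.\<close>

lemma indep_iff_exact_labeling:
  assumes "W \<subseteq> verts G"
  shows "indep (TM_del G W) X \<longleftrightarrow>
    X \<subseteq> S_G G (verts G - W) \<and> (\<exists>\<phi>. exact_labeling G (mult X) \<phi>)"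
proof (cases "X \<subseteq> S_G G (verts G - W)")
  case False
  then show ?thesis
    by (simp add: indep_def ground_TM_del[OF assms])
next
  case X: True
  let ?H = "{height G \<phi> | \<phi>. labeling G (mult X) \<phi>}"
  note card_X = card_eq_sum_mult[OF _ X, simplified]
  have fin_X: "finite X"
    using X finite_S_G[of "verts G - W"] finite_subset by blast
  have le: "height G \<phi> \<le> card X" if "labeling G (mult X) \<phi>" for \<phi>
    using that unfolding labeling_def card_X by (auto simp: height_eq_sum intro: sum_mono)
  have eq_iff: "labeling G (mult X) \<phi> \<and> height G \<phi> = card X \<longleftrightarrow> exact_labeling G (mult X) \<phi>" for \<phi>
  proof
    assume L: "labeling G (mult X) \<phi> \<and> height G \<phi> = card X"
    then have "height G \<phi> = (\<Sum>v\<in>verts G. card {e \<in> edges G. \<phi> e = Some v})"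
      by (intro height_eq_sum) (simp add: labeling_def)
    with L have "(\<Sum>v\<in>verts G. card {e \<in> edges G. \<phi> e = Some v}) = (\<Sum>v\<in>verts G. mult X v)"
      by (simp add: card_X)
    then have "card {e \<in> edges G. \<phi> e = Some v} = mult X v" if "v \<in> verts G" for v
      by (rule sum_mono_inv) (use L that finite_verts in \<open>simp_all add: labeling_def\<close>)
    with L show "exact_labeling G (mult X) \<phi>"
      by (simp add: exact_labeling_def labeling_def)
  next
    assume "exact_labeling G (mult X) \<phi>"
    then show "labeling G (mult X) \<phi> \<and> height G \<phi> = card X"
      by (simp add: exact_labeling_def labeling_def height_eq_sum card_X)
  qed
  have fin: "finite ?H"
    by (rule finite_subset[of _ "{..card X}"]) (use le in auto)
  have "labeling G (mult X) (\<lambda>_. None)"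
    by (simp add: labeling_def)
  then have "?H \<noteq> {}"
    by blast
  \<comment> \<open>Since \<open>card X\<close> bounds all heights, the maximum reaches it iff some
    labeling does; the labeling that is \<open>None\<close> everywhere ensures that the maximum is
    over a nonempty set.\<close>
  then have "Max ?H = card X \<longleftrightarrow> card X \<in> ?H"
    using fin le by (subst Max_eq_iff) auto
  also have "\<dots> \<longleftrightarrow> (\<exists>\<phi>. exact_labeling G (mult X) \<phi>)"
    using eq_iff by force
  finally show ?thesis
    using X fin_X ground_TM_del[OF assms]
    by (simp add: indep_def TM_del_def TM_def matroid_delete_def label_rank_def)
qed

section \<open>Bases expressed by covering labelings\<close>

lemma exact_labeling_label_in:
  assumes "X \<subseteq> S_G G U" and "exact_labeling G (mult X) \<phi>"
    and "e \<in> edges G" and "\<phi> e = Some v"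
  shows "v \<in> U" and "v \<in> set_uprod (ends G e)"
proof -
  show v: "v \<in> set_uprod (ends G e)"
    using assms by (auto simp: exact_labeling_def)
  show "v \<in> U"
  proof (rule ccontr)
    assume "v \<notin> U"
    moreover have "v \<in> verts G"
      using v ends_in_verts assms(3) by blast
    \<comment> \<open>A vertex off \<open>U\<close> has multiplicity 0, so exactness forbids it as a
      label, although \<open>e\<close> carries it.\<close>
    ultimately have "card {e \<in> edges G. \<phi> e = Some v} = 0"
      using assms mult_eq_0 by (simp add: exact_labeling_def)
    with assms(3,4) finite_edges show False
      by auto
  qed
qed

text \<open>Labeling \<open>e\<close> with \<open>v\<close> raises one label count by 1, so
  exactness asks for one more copy of \<open>v\<close>. A copy outside \<open>X\<close> exists
  because \<open>v\<close> labels fewer edges than are incident to it, hence fewer than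
  \<open>deg G v\<close>.\<close>

lemma exact_labeling_extend:
  assumes "U \<subseteq> verts G" and X: "X \<subseteq> S_G G U" and \<phi>: "exact_labeling G (mult X) \<phi>"
    and e: "e \<in> edges G" "\<phi> e = None" and v: "v \<in> set_uprod (ends G e)" "v \<in> U"
  obtains x where "x \<notin> X" and "insert x X \<subseteq> S_G G U"
    and "exact_labeling G (mult (insert x X)) (\<phi>(e := Some v))"
proof -
  have label: "u \<in> set_uprod (ends G e')" if "e' \<in> edges G" "\<phi> e' = Some u" for e' u
    using exact_labeling_label_in[OF X \<phi> that] by simp
  have "mult X v = card {e \<in> edges G. \<phi> e = Some v}"
    using \<phi> v assms(1) by (auto simp: exact_labeling_def)
  also have "\<dots> < card {e \<in> edges G. v \<in> set_uprod (ends G e)}"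
  proof (intro psubset_card_mono psubsetI)
    \<comment> \<open>The unlabeled edge \<open>e\<close> itself makes the inclusion strict.\<close>
    have "e \<in> {e \<in> edges G. v \<in> set_uprod (ends G e)}" "e \<notin> {e \<in> edges G. \<phi> e = Some v}"
      using e v by auto
    then show "{e \<in> edges G. \<phi> e = Some v} \<noteq> {e \<in> edges G. v \<in> set_uprod (ends G e)}"
      by blast
  qed (use finite_edges label in auto)
  also have "\<dots> \<le> deg G v"
    by (simp add: deg_def)
  finally have less: "card {i. (v, i) \<in> X} < card {1..deg G v}"
    by (simp add: mult_def)
  have fin: "finite {i. (v, i) \<in> X}"
    by (rule finite_subset[of _ "{1..deg G v}"]) (use X in \<open>auto simp: S_G_def\<close>)
  have "\<not> {1..deg G v} \<subseteq> {i. (v, i) \<in> X}"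
    using less card_mono[OF fin] by (metis not_le)
  then obtain i where i: "i \<in> {1..deg G v}" "(v, i) \<notin> X"
    by blast
  have mult_v: "mult (insert (v, i) X) v = Suc (mult X v)"
  proof -
    have "{j. (v, j) \<in> insert (v, i) X} = insert i {j. (v, j) \<in> X}"
      by auto
    then show ?thesis
      using fin i by (simp add: mult_def)
  qed
  have mult_other: "mult (insert (v, i) X) u = mult X u" if "u \<noteq> v" for u
    using that by (simp add: mult_def)
  have count_v: "card {e' \<in> edges G. (\<phi>(e := Some v)) e' = Some v} =
      Suc (card {e' \<in> edges G. \<phi> e' = Some v})"
  proof -
    have "{e' \<in> edges G. (\<phi>(e := Some v)) e' = Some v} = insert e {e' \<in> edges G. \<phi> e' = Some v}"
      using e by auto
    then show ?thesis
      using finite_edges e by simp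
  qed
  have count_other: "{e' \<in> edges G. (\<phi>(e := Some v)) e' = Some u} = {e' \<in> edges G. \<phi> e' = Some u}"
    if "u \<noteq> v" for u
    using that e by auto
  have "card {e' \<in> edges G. (\<phi>(e := Some v)) e' = Some u} = mult (insert (v, i) X) u"
    if "u \<in> verts G" for u
  proof (cases "u = v")
    case True
    show ?thesis
      unfolding True mult_v count_v using True that \<phi> by (simp add: exact_labeling_def)
  next
    case False
    show ?thesis
      unfolding mult_other[OF False] count_other[OF False]
      using that \<phi> by (simp add: exact_labeling_def)
  qed
  moreover have "\<forall>e' \<in> edges G. (\<phi>(e := Some v)) e' \<in> insert None (Some ` set_uprod (ends G e'))"
    using \<phi> v by (auto simp: exact_labeling_def)
  ultimately have "exact_labeling G (mult (insert (v, i) X)) (\<phi>(e := Some v))"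
    unfolding exact_labeling_def by blast
  moreover have "insert (v, i) X \<subseteq> S_G G U"
    using X i v by (auto simp: S_G_def)
  ultimately show ?thesis
    using that i by blast
qed

text \<open>An uncovered edge would allow an enlargement of \<open>B\<close>. Conversely, a covering
  labeling labels at least the edges labeled for any other independent set over \<open>U\<close>,
  and the height of an exact labeling is the size of its set, so no independent set is larger than
  \<open>B\<close>.\<close>

lemma basis_iff_covering_labeling:
  assumes W: "W \<subseteq> verts G"
  defines "U \<equiv> verts G - W"
  shows "basis (TM_del G W) B \<longleftrightarrow>
    B \<subseteq> S_G G U \<and> (\<exists>\<phi>. exact_labeling G (mult B) \<phi> \<and> covers G U \<phi>)"
proof
  assume basis: "basis (TM_del G W) B"
  then obtain \<phi> where B: "B \<subseteq> S_G G U" and \<phi>: "exact_labeling G (mult B) \<phi>"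
    by (auto simp: basis_def indep_iff_exact_labeling[OF W] U_def)
  have "covers G U \<phi>"
  proof (rule ccontr)
    assume "\<not> covers G U \<phi>"
    then obtain e v where "e \<in> edges G" "\<phi> e = None" "v \<in> set_uprod (ends G e)" "v \<in> U"
      by (auto simp: covers_def)
    then obtain x where "x \<notin> B" "insert x B \<subseteq> S_G G U"
      "exact_labeling G (mult (insert x B)) (\<phi>(e := Some v))"
      using exact_labeling_extend[OF _ B \<phi>] unfolding U_def by blast
    then have "indep (TM_del G W) (insert x B)"
      by (auto simp: indep_iff_exact_labeling[OF W] U_def)
    with basis \<open>x \<notin> B\<close> show False
      by (auto simp: basis_def)
  qed
  with B \<phi> show "B \<subseteq> S_G G U \<and> (\<exists>\<phi>. exact_labeling G (mult B) \<phi> \<and> covers G U \<phi>)"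
    by blast
next
  assume "B \<subseteq> S_G G U \<and> (\<exists>\<phi>. exact_labeling G (mult B) \<phi> \<and> covers G U \<phi>)"
  then obtain \<phi> where B: "B \<subseteq> S_G G U" and \<phi>: "exact_labeling G (mult B) \<phi>" "covers G U \<phi>"
    by blast
  have card_height: "card X = height G \<psi>" if "X \<subseteq> S_G G U" "exact_labeling G (mult X) \<psi>" for X \<psi>
    using that card_eq_sum_mult[of U X] by (simp add: U_def exact_labeling_def height_eq_sum)
  have "X = B" if "indep (TM_del G W) X" "B \<subseteq> X" for X
  proof -
    obtain \<psi> where X: "X \<subseteq> S_G G U" and \<psi>: "exact_labeling G (mult X) \<psi>"
      using \<open>indep (TM_del G W) X\<close> by (auto simp: indep_iff_exact_labeling[OF W] U_def)
    \<comment> \<open>The label that \<open>\<psi>\<close> gives to an edge is an end in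
      \<open>U\<close>, so the edge meets \<open>U\<close> and is covered by
      \<open>\<phi>\<close>.\<close>
    have "{e \<in> edges G. \<psi> e \<noteq> None} \<subseteq> {e \<in> edges G. \<phi> e \<noteq> None}"
      using exact_labeling_label_in[OF X \<psi>] \<phi>(2) by (fastforce simp: covers_def)
    then have "height G \<psi> \<le> height G \<phi>"
      unfolding height_def using finite_edges by (intro card_mono) auto
    then have "card X \<le> card B"
      using card_height B X \<phi> \<psi> by simp
    moreover have "finite X"
      using X finite_S_G[of U] finite_subset unfolding U_def by blast
    ultimately show ?thesis
      using \<open>B \<subseteq> X\<close> by (metis card_seteq)
  qed
  with B \<phi> show "basis (TM_del G W) B"
    by (auto simp: basis_def indep_iff_exact_labeling[OF W] U_def)
qed

section \<open>From covering labelings to orientations of the induced subgraph and back\<close>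

lemma deg_eq_out_deg_plus_heads:
  assumes "orientation (induced_subgraph G U) \<O>" and v: "v \<in> U"
    and inner: "\<And>e. e \<in> edges G \<Longrightarrow> set_uprod (ends G e) \<subseteq> U \<Longrightarrow> \<phi> e = Some (snd (\<O> e))"
    and cross: "\<And>e. e \<in> edges G \<Longrightarrow> \<not> set_uprod (ends G e) \<subseteq> U \<Longrightarrow>
      \<phi> e = Some v \<longleftrightarrow> v \<in> set_uprod (ends G e)"
  shows "deg G v = out_deg (induced_subgraph G U) \<O> v + card {e \<in> edges G. \<phi> e = Some v}"
proof -
  let ?H = "induced_subgraph G U"
  \<comment> \<open>These are the edges joining \<open>v\<close> to a vertex outside
    \<open>U\<close>. Each is labeled \<open>v\<close> and, not being a loop, adds 1 to the degree.
    So \<open>deg G v\<close> exceeds the degree of \<open>v\<close> in \<open>?H\<close> by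
    \<open>card ?C\<close>, and the label count exceeds the in-degree by the same amount.\<close>
  let ?C = "{e \<in> edges G. \<not> set_uprod (ends G e) \<subseteq> U \<and> v \<in> set_uprod (ends G e)}"
  have fin: "finite (edges ?H)"
    using finite_edges by (simp add: induced_subgraph_def)
  have "{e \<in> edges G. v \<in> set_uprod (ends G e)} = {e \<in> edges ?H. v \<in> set_uprod (ends ?H e)} \<union> ?C"
    by (auto simp: induced_subgraph_def)
  moreover have "card ({e \<in> edges ?H. v \<in> set_uprod (ends ?H e)} \<union> ?C) =
      card {e \<in> edges ?H. v \<in> set_uprod (ends ?H e)} + card ?C"
    using finite_edges by (intro card_Un_disjoint) (auto simp: induced_subgraph_def)
  \<comment> \<open>As \<open>v\<close> is in \<open>U\<close>, its loops all survive in
    \<open>?H\<close>; the loop term of the degree is unchanged.\<close>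
  moreover have "{e \<in> edges G. ends G e = Upair v v} = {e \<in> edges ?H. ends ?H e = Upair v v}"
    using v by (auto simp: induced_subgraph_def)
  ultimately have deg: "deg G v = deg ?H v + card ?C"
    by (simp add: deg_def)
  have "{e \<in> edges G. \<phi> e = Some v} = {e \<in> edges ?H. snd (\<O> e) = v} \<union> ?C"
  proof (rule set_eqI)
    fix e
    show "e \<in> {e \<in> edges G. \<phi> e = Some v} \<longleftrightarrow> e \<in> {e \<in> edges ?H. snd (\<O> e) = v} \<union> ?C"
      using inner[of e] cross[of e]
      by (cases "set_uprod (ends G e) \<subseteq> U") (auto simp: induced_subgraph_def)
  qed
  moreover have "card ({e \<in> edges ?H. snd (\<O> e) = v} \<union> ?C) =
      card {e \<in> edges ?H. snd (\<O> e) = v} + card ?C"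
    using finite_edges by (intro card_Un_disjoint) (auto simp: induced_subgraph_def)
  ultimately show ?thesis
    using deg out_deg_plus_in_deg[OF fin assms(1), of v] by simp
qed

lemma orientation_imp_covering_labeling:
  assumes \<O>: "orientation (induced_subgraph G U) \<O>"
  obtains \<phi> where "\<forall>e \<in> edges G. \<phi> e \<in> insert None (Some ` (set_uprod (ends G e) \<inter> U))"
    and "covers G U \<phi>"
    and "\<And>v. v \<in> U \<Longrightarrow>
      deg G v = out_deg (induced_subgraph G U) \<O> v + card {e \<in> edges G. \<phi> e = Some v}"
proof -
  \<comment> \<open>An inner edge is labeled by its head. An edge that meets \<open>U\<close>
    without lying inside it has exactly one end in \<open>U\<close>, so \<open>SOME\<close> has a
    single candidate there.\<close>
  define \<phi> where "\<phi> e =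
    (if set_uprod (ends G e) \<subseteq> U then Some (snd (\<O> e))
     else if set_uprod (ends G e) \<inter> U = {} then None
     else Some (SOME v. v \<in> set_uprod (ends G e) \<inter> U))" for e
  have snd_in: "snd (\<O> e) \<in> set_uprod (ends G e)"
    if "e \<in> edges G" "set_uprod (ends G e) \<subseteq> U" for e
  proof -
    have "ends G e = Upair (fst (\<O> e)) (snd (\<O> e))"
      using \<O> that by (simp add: orientation_def induced_subgraph_def)
    then show ?thesis
      by simp
  qed
  have some_in: "(SOME v. v \<in> set_uprod (ends G e) \<inter> U) \<in> set_uprod (ends G e) \<inter> U"
    if "set_uprod (ends G e) \<inter> U \<noteq> {}" for e
    using that by (metis (mono_tags) ex_in_conv someI_ex)
  have label: "\<phi> e \<in> insert None (Some ` (set_uprod (ends G e) \<inter> U))" if "e \<in> edges G" for e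
    using snd_in[OF that] some_in[of e] unfolding \<phi>_def by auto
  moreover have "covers G U \<phi>"
    by (simp add: covers_def \<phi>_def)
  moreover have "deg G v = out_deg (induced_subgraph G U) \<O> v + card {e \<in> edges G. \<phi> e = Some v}"
    if "v \<in> U" for v
  proof (rule deg_eq_out_deg_plus_heads[OF \<O> that])
    show "\<phi> e = Some (snd (\<O> e))" if "set_uprod (ends G e) \<subseteq> U" for e
      using that by (simp add: \<phi>_def)
    show "\<phi> e = Some v \<longleftrightarrow> v \<in> set_uprod (ends G e)"
      if "e \<in> edges G" "\<not> set_uprod (ends G e) \<subseteq> U" for e
    proof
      assume "v \<in> set_uprod (ends G e)"
      with \<open>v \<in> U\<close> that(2) have "set_uprod (ends G e) \<inter> U = {v}"
        by (cases "ends G e") auto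
      then show "\<phi> e = Some v"
        using that(2) by (simp add: \<phi>_def)
    qed (use label[OF that(1)] in auto)
  qed
  ultimately show ?thesis
    using that by blast
qed

text \<open>On an edge inside \<open>U\<close> the label, present by covering, becomes the head and
  the other end the tail; for a loop the two coincide. On an edge leaving \<open>U\<close> the label
  can only be its end in \<open>U\<close>.\<close>

lemma covering_labeling_imp_orientation:
  assumes U: "U \<subseteq> verts G" and B: "B \<subseteq> S_G G U"
    and \<phi>: "exact_labeling G (mult B) \<phi>" "covers G U \<phi>"
  obtains \<O> where "orientation (induced_subgraph G U) \<O>"
    and "\<And>v. v \<in> U \<Longrightarrow> deg G v = out_deg (induced_subgraph G U) \<O> v + mult B v"
proof -
  have "\<exists>p. Upair (fst p) (snd p) = ends G e \<and> \<phi> e = Some (snd p)"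
    if "e \<in> edges G" "set_uprod (ends G e) \<subseteq> U" for e
  proof -
    have "set_uprod (ends G e) \<inter> U \<noteq> {}"
      using that(2) by (cases "ends G e") auto
    with \<phi>(2) that(1) have "\<phi> e \<noteq> None"
      unfolding covers_def by blast
    then obtain v where v: "\<phi> e = Some v"
      by blast
    then have "v \<in> set_uprod (ends G e)"
      using exact_labeling_label_in[OF B \<phi>(1) that(1)] by simp
    then obtain w where "ends G e = Upair w v"
      by (cases "ends G e") auto
    with v show ?thesis
      by (intro exI[of _ "(w, v)"]) simp
  qed
  then obtain \<O> where \<O>: "Upair (fst (\<O> e)) (snd (\<O> e)) = ends G e \<and> \<phi> e = Some (snd (\<O> e))"
    if "e \<in> edges G" "set_uprod (ends G e) \<subseteq> U" for e
    by metis
  have ori: "orientation (induced_subgraph G U) \<O>"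
    using \<O> by (auto simp: orientation_def induced_subgraph_def)
  have "deg G v = out_deg (induced_subgraph G U) \<O> v + mult B v" if v: "v \<in> U" for v
  proof -
    have "\<phi> e = Some v \<longleftrightarrow> v \<in> set_uprod (ends G e)"
      if e: "e \<in> edges G" and cross: "\<not> set_uprod (ends G e) \<subseteq> U" for e
    proof
      assume in_e: "v \<in> set_uprod (ends G e)"
      with v \<phi>(2) e obtain u where u: "\<phi> e = Some u"
        by (auto simp: covers_def)
      have "set_uprod (ends G e) \<inter> U = {v}"
        using in_e cross v by (cases "ends G e") auto
      then show "\<phi> e = Some v"
        using exact_labeling_label_in[OF B \<phi>(1) e u] u by auto
    qed (use exact_labeling_label_in[OF B \<phi>(1) e] in auto)
    then have "deg G v = out_deg (induced_subgraph G U) \<O> v + card {e \<in> edges G. \<phi> e = Some v}"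
      using \<O> by (intro deg_eq_out_deg_plus_heads[OF ori v]) auto
    with \<phi>(1) U v show ?thesis
      by (auto simp: exact_labeling_def)
  qed
  with ori show ?thesis
    using that by blast
qed

text \<open>Labelings are eliminated here: whether a set over \<open>U\<close> is a basis depends
  only on its multiplicities, which must be the degrees in \<open>G\<close> minus the out-degrees of
  some orientation.\<close>

lemma basis_iff_orientation:
  assumes W: "W \<subseteq> verts G"
  defines "U \<equiv> verts G - W"
  shows "basis (TM_del G W) B \<longleftrightarrow> B \<subseteq> S_G G U \<and>
    (\<exists>\<O>. orientation (induced_subgraph G U) \<O> \<and>
       (\<forall>v\<in>U. deg G v = out_deg (induced_subgraph G U) \<O> v + mult B v))"
proof -
  have U: "U \<subseteq> verts G"
    by (auto simp: U_def)
  have "\<exists>\<phi>. exact_labeling G (mult B) \<phi> \<and> covers G U \<phi>"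
    if B: "B \<subseteq> S_G G U" and \<O>: "orientation (induced_subgraph G U) \<O>"
      and deg: "\<forall>v\<in>U. deg G v = out_deg (induced_subgraph G U) \<O> v + mult B v" for \<O>
  proof -
    obtain \<phi> where \<phi>: "\<forall>e \<in> edges G. \<phi> e \<in> insert None (Some ` (set_uprod (ends G e) \<inter> U))"
      and cov: "covers G U \<phi>"
      and heads: "\<And>v. v \<in> U \<Longrightarrow>
        deg G v = out_deg (induced_subgraph G U) \<O> v + card {e \<in> edges G. \<phi> e = Some v}"
      using orientation_imp_covering_labeling[OF \<O>] by blast
    \<comment> \<open>On \<open>U\<close> the two expressions for \<open>deg G v\<close> cancel to
      the claim; off \<open>U\<close> both sides are 0, as labels and elements of \<open>B\<close>
      lie over \<open>U\<close>.\<close>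
    have "card {e \<in> edges G. \<phi> e = Some v} = mult B v" for v
    proof (cases "v \<in> U")
      case True
      then show ?thesis
        using heads[OF True] deg by simp
    next
      case False
      then have "{e \<in> edges G. \<phi> e = Some v} = {}"
        using \<phi> by force
      then show ?thesis
        using mult_eq_0[OF B False] by (simp only: card.empty)
    qed
    then have "exact_labeling G (mult B) \<phi>"
      using \<phi> by (auto simp: exact_labeling_def)
    with cov show ?thesis
      by blast
  qed
  moreover have "\<exists>\<O>. orientation (induced_subgraph G U) \<O> \<and>
      (\<forall>v\<in>U. deg G v = out_deg (induced_subgraph G U) \<O> v + mult B v)"
    if "B \<subseteq> S_G G U" "exact_labeling G (mult B) \<phi>" "covers G U \<phi>" for \<phi>
    using covering_labeling_imp_orientation[OF U that] by metis
  ultimately show ?thesis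
    using basis_iff_covering_labeling[OF W] unfolding U_def by blast
qed

text \<open>This bound makes the natural-number difference of degree and out-degree a true one and
  licenses the symmetry of the binomial coefficient.\<close>

lemma out_deg_induced_le_deg:
  assumes "orientation (induced_subgraph G U) \<O>"
  shows "out_deg (induced_subgraph G U) \<O> v \<le> deg G v"
proof -
  have tail: "fst (\<O> e) \<in> set_uprod (ends G e)" if "e \<in> edges (induced_subgraph G U)" for e
  proof -
    have "ends G e = Upair (fst (\<O> e)) (snd (\<O> e))"
      using assms that by (simp add: orientation_def induced_subgraph_def)
    then show ?thesis
      by simp
  qed
  have "out_deg (induced_subgraph G U) \<O> v \<le> card {e \<in> edges G. v \<in> set_uprod (ends G e)}"
    unfolding out_deg_def
  proof (rule card_mono)
    show "{e \<in> edges (induced_subgraph G U). fst (\<O> e) = v} \<subseteq>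
        {e \<in> edges G. v \<in> set_uprod (ends G e)}"
      using tail by (auto simp: induced_subgraph_def)
  qed (use finite_edges in simp)
  then show ?thesis
    by (simp add: deg_def)
qed

end

section \<open>Counting the bases by out-degree vector\<close>

theorem theorem1p3:
  fixes G :: "('v, 'e) multigraph" and W :: "'v set" and vs :: "'v list" and n :: nat
  assumes "fin_multigraph G"
    and "W \<subseteq> verts G"
    and "distinct vs" and "length vs = n" and "set vs = verts G - W"
  shows "card {B. basis (TM_del G W) B} =
    (\<Sum>a \<in> D_plus (induced_subgraph G (verts G - W)) vs.
       \<Prod>i<n. deg G (vs ! i) choose (a ! i))"
proof -
  interpret fin_multigraph G
    by fact
  define U where "U = verts G - W"
  define H where "H = induced_subgraph G U"
  \<comment> \<open>The bases that belong to the out-degree vector \<open>a\<close>. The additive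
    form of the condition avoids truncated subtraction.\<close>
  define F where "F a = {B. B \<subseteq> S_G G U \<and> (\<forall>i<n. deg G (vs ! i) = a ! i + mult B (vs ! i))}"
    for a :: "nat list"
  have ball_U: "(\<forall>v\<in>U. P v) \<longleftrightarrow> (\<forall>i<n. P (vs ! i))" for P
    using assms(4,5) by (metis U_def all_set_conv_all_nth)
  have bases: "{B. basis (TM_del G W) B} = (\<Union>a\<in>D_plus H vs. F a)"
  proof -
    have "basis (TM_del G W) B \<longleftrightarrow> B \<subseteq> S_G G U \<and> (\<exists>\<O>. orientation H \<O> \<and>
        (\<forall>i<n. deg G (vs ! i) = out_deg H \<O> (vs ! i) + mult B (vs ! i)))" for B
      using basis_iff_orientation[OF assms(2), folded U_def, folded H_def] by (simp add: ball_U)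
    then show ?thesis
      using assms(4) by (auto simp: D_plus_def F_def)
  qed
  have card_F: "card (F a) = (\<Prod>i<n. deg G (vs ! i) choose (a ! i))" if a: "a \<in> D_plus H vs" for a
  proof -
    obtain \<O> where \<O>: "orientation H \<O>" "a = map (out_deg H \<O>) vs"
      using a by (auto simp: D_plus_def)
    have le: "out_deg H \<O> v \<le> deg G v" for v
      using out_deg_induced_le_deg \<O> by (simp add: H_def)
    have "deg G v = out_deg H \<O> v + k \<longleftrightarrow> k = deg G v - out_deg H \<O> v" for v k
      using le[of v] by linarith
    then have "F a = {B. B \<subseteq> Sigma U (\<lambda>v. {1..deg G v}) \<and>
        (\<forall>v\<in>U. card {i. (v, i) \<in> B} = deg G v - out_deg H \<O> v)}"
      using \<O>(2) assms(4) by (simp add: F_def S_G_eq_Sigma ball_U mult_def)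
    then have "card (F a) = (\<Prod>v\<in>U. deg G v choose (deg G v - out_deg H \<O> v))"
      using finite_verts by (simp add: card_subsets_Sigma_fibres U_def)
    \<comment> \<open>A basis contains \<open>deg G v - out_deg H \<O> v\<close> copies of
      \<open>v\<close>; choosing these amounts to choosing the copies left out.\<close>
    also have "\<dots> = (\<Prod>v\<in>U. deg G v choose out_deg H \<O> v)"
      using le by (simp add: binomial_symmetric[symmetric])
    also have "\<dots> = (\<Prod>i<n. deg G (vs ! i) choose out_deg H \<O> (vs ! i))"
      using assms(3-5)
      by (intro prod.reindex_bij_betw[symmetric] bij_betw_nth) (auto simp: U_def)
    finally show ?thesis
      using \<O>(2) assms(4) by simp
  qed
  \<comment> \<open>A set in \<open>F a\<close> determines every entry of \<open>a\<close> as degree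
    minus multiplicity, so no basis is counted for two vectors.\<close>
  have "F a \<inter> F b = {}" if "a \<in> D_plus H vs" "b \<in> D_plus H vs" "a \<noteq> b" for a b
  proof -
    have "length a = n" "length b = n"
      using that assms(4) by (auto simp: D_plus_def)
    with \<open>a \<noteq> b\<close> obtain i where "i < n" "a ! i \<noteq> b ! i"
      using nth_equalityI[of a b] by auto
    then show ?thesis
      by (fastforce simp: F_def)
  qed
  moreover have "finite (F a)" for a
    using finite_S_G[of U] by (auto simp: F_def U_def intro: finite_subset[of _ "Pow (S_G G U)"])
  moreover have "finite (D_plus H vs)"
    using finite_edges by (intro finite_D_plus) (simp add: H_def induced_subgraph_def)
  ultimately have "card {B. basis (TM_del G W) B} = (\<Sum>a\<in>D_plus H vs. card (F a))"
    unfolding bases by (intro card_UN_disjoint) auto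
  also have "\<dots> = (\<Sum>a\<in>D_plus H vs. \<Prod>i<n. deg G (vs ! i) choose (a ! i))"
    by (intro sum.cong refl card_F)
  finally show ?thesis
    by (simp add: H_def U_def)
qed

end
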